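(* Let $k>0$ be real and let $x,y$ and all parameters be complex. (i) If $\Re(\gamma)>\Re(\beta)>0$, $\Re(\gamma')>\Re(\beta')>0$ and $|x|+|y|<\frac1k$, then $$F_{2,k}(\alpha,\beta,\beta';\gamma,\gamma';x,y)=\frac{1}{k^{2}B_{k}(\beta,\gamma-\beta)B_{k}(\beta',\gamma'-\beta')}\int_{0}^{1}\int_{0}^{1}\frac{t^{\frac{\beta}{k}-1}s^{\frac{\beta'}{k}-1}(1-t)^{\frac{\gamma-\beta}{k}-1}(1-s)^{\frac{\gamma'-\beta'}{k}-1}}{(1-kxt-kys)^{\frac{\alpha}{k}}}\,dt\,ds.$$ (ii) If $\Re(\beta)>0$, $\Re(\beta')>0$, $\Re(\gamma-\beta-\beta')>0$, $|x|<\frac1k$ and $|y|<\frac1k$, then $$F_{3,k}(\alpha,\alpha',\beta,\beta';\gamma;x,y)=\frac{\Gamma_{k}(\gamma)}{k^{2}\Gamma_{k}(\beta)\Gamma_{k}(\beta')\Gamma_{k}(\gamma-\beta-\beta')}\iint_{D}\frac{t^{\frac{\beta}{k}-1}s^{\frac{\beta'}{k}-1}(1-kxt)^{-\frac{\alpha}{k}}(1-kys)^{-\frac{\alpha'}{k}}}{(1-t-s)^{1-\frac{\gamma-\beta-\beta'}{k}}}\,dt\,ds,$$ where $D=\{(t,s): t\ge 0,\ s\ge 0,\ t+s\le 1\}$.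
   Context: For real $k>0$, $a\in\mathbb{C}$ and an integer $n\ge 1$, the Pochhammer $k$-symbol is $(a)_{n,k}=a(a+k)(a+2k)\cdots(a+(n-1)k)$, and $(a)_{0,k}=1$. The $k$-gamma function is $\Gamma_k(x)=\int_0^\infty t^{x-1}e^{-t^k/k}\,dt$ for $\Re(x)>0$, and the $k$-beta function is $B_k(x,y)=\frac1k\int_0^1 t^{\frac xk-1}(1-t)^{\frac yk-1}\,dt$ for $\Re(x),\Re(y)>0$. The Appell $k$-functions are $$F_{2,k}(\alpha,\beta,\beta';\gamma,\gamma';x,y)=\sum_{m,n=0}^\infty\frac{(\alpha)_{m+n,k}(\beta)_{m,k}(\beta')_{n,k}}{(\gamma)_{m,k}(\gamma')_{n,k}}\frac{x^m}{m!}\frac{y^n}{n!},\qquad |x|+|y|<\tfrac1k,$$ $$F_{3,k}(\alpha,\alpha',\beta,\beta';\gamma;x,y)=\sum_{m,n=0}^\infty\frac{(\alpha)_{m,k}(\alpha')_{n,k}(\beta)_{m,k}(\beta')_{n,k}}{(\gamma)_{m+n,k}}\frac{x^m}{m!}\frac{y^n}{n!},\qquad |x|<\tfrac1k,\ |y|<\tfrac1k.$$ Complex powers are principal values. *)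

theory Defs
  imports "HOL-Analysis.Analysis"
begin

definition k_pochhammer :: "real \<Rightarrow> complex \<Rightarrow> nat \<Rightarrow> complex" where
  "k_pochhammer k a n = (\<Prod>i<n. a + of_nat i * of_real k)"

text \<open>
  The integrals below are Lebesgue integrals. The integrals defining \<open>k_Gamma k x\<close> for
  \<open>Re x > 0\<close> and \<open>k_Beta k x y\<close> for \<open>Re x > 0\<close>, \<open>Re y > 0\<close> converge absolutely (for \<open>k > 0\<close>);
  outside these domains the definitions are not meant to be used.
\<close>

definition k_Gamma :: "real \<Rightarrow> complex \<Rightarrow> complex" where
  "k_Gamma k x =
     (LBINT t=0..\<infinity>. of_real t powr (x - 1) * of_real (exp (- (t powr k) / k)))"

definition k_Beta :: "real \<Rightarrow> complex \<Rightarrow> complex \<Rightarrow> complex" where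
  "k_Beta k x y =
     1 / of_real k *
     (LBINT t=0..1. of_real t powr (x / of_real k - 1) * of_real (1 - t) powr (y / of_real k - 1))"

text \<open>
  The Appell double series are unconditional sums over all pairs \<open>(m, n)\<close> of naturals. They are
  used for \<open>\<bar>x\<bar> + \<bar>y\<bar> < 1 / k\<close> and for \<open>\<bar>x\<bar> < 1 / k\<close>, \<open>\<bar>y\<bar> < 1 / k\<close>, respectively, where they
  converge absolutely.
\<close>

definition k_Appell_F2 ::
  "real \<Rightarrow> complex \<Rightarrow> complex \<Rightarrow> complex \<Rightarrow> complex \<Rightarrow> complex \<Rightarrow> complex \<Rightarrow> complex \<Rightarrow> complex" where
  "k_Appell_F2 k \<alpha> \<beta> \<beta>' \<gamma> \<gamma>' x y =
     (\<Sum>\<^sub>\<infinity>(m, n)\<in>UNIV.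
        k_pochhammer k \<alpha> (m + n) * k_pochhammer k \<beta> m * k_pochhammer k \<beta>' n /
        (k_pochhammer k \<gamma> m * k_pochhammer k \<gamma>' n) *
        (x ^ m / fact m) * (y ^ n / fact n))"

definition k_Appell_F3 ::
  "real \<Rightarrow> complex \<Rightarrow> complex \<Rightarrow> complex \<Rightarrow> complex \<Rightarrow> complex \<Rightarrow> complex \<Rightarrow> complex \<Rightarrow> complex" where
  "k_Appell_F3 k \<alpha> \<alpha>' \<beta> \<beta>' \<gamma> x y =
     (\<Sum>\<^sub>\<infinity>(m, n)\<in>UNIV.
        k_pochhammer k \<alpha> m * k_pochhammer k \<alpha>' n * k_pochhammer k \<beta> m * k_pochhammer k \<beta>' n /
        k_pochhammer k \<gamma> (m + n) *
        (x ^ m / fact m) * (y ^ n / fact n))"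

end

theory Submission
  imports Defs
begin

text \<open>
  Both formulas are the classical Euler integrals of the Appell functions \<open>F\<^sub>2\<close> and \<open>F\<^sub>3\<close> in
  disguise: \<open>(a)\<^bsub>n,k\<^esub>\<close> is \<open>k\<^sup>n\<close> times the ordinary Pochhammer symbol of \<open>a / k\<close>, so the series are
  the ordinary Appell series with all parameters divided by \<open>k\<close> and the arguments replaced by \<open>k x\<close>
  and \<open>k y\<close>. Correspondingly \<open>k_Beta\<close> and \<open>k_Gamma\<close> are the ordinary Beta and Gamma functions up
  to elementary factors.

  For the ordinary functions, the factors of the integrand that carry \<open>x\<close> and \<open>y\<close> expand by the
  binomial theorem into an absolutely convergent double series in \<open>t\<^sup>m s\<^sup>n\<close>. What remains is an
  integrable weight, on whose support \<open>t\<close> and \<open>s\<close> lie between \<open>0\<close> and \<open>1\<close>, so one may integrate term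
  by term (\<open>has_sum_integral_weighted\<close>); the moments of the weight produce exactly the remaining
  Pochhammer quotients. For \<open>F\<^sub>2\<close> the weight is a product of two Beta densities (\<open>Beta_moment\<close>), for
  \<open>F\<^sub>3\<close> it is the Dirichlet density on the simplex (\<open>Dirichlet_moment\<close>).

  All integrals of weights come from one identity. For the truncated powers
  \<open>t\<^sub>+\<^sup>a\<^sup>-\<^sup>1\<close>, the convolution of the powers with parameters \<open>a\<close> and \<open>b\<close> is \<open>Beta a b\<close> times the power
  with parameter \<open>a + b\<close> (\<open>trunc_powr_convolution\<close>). Evaluated at \<open>1\<close> it is Euler's Beta integral;
  used twice it is the Dirichlet integral.
\<close>

section \<open>Truncated powers, Beta and Gamma integrals\<close>

text \<open>
  Building the domain of integration into the function makes the simplex and the intervals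
  disappear: every integral below is over the whole line or plane. The exponent is \<open>a - 1\<close> so that
  parameters add under convolution.
\<close>

definition trunc_powr :: "complex \<Rightarrow> real \<Rightarrow> complex" where
  "trunc_powr a t = (if 0 < t then of_real t powr (a - 1) else 0)"

lemma trunc_powr_measurable [measurable]: "trunc_powr a \<in> borel_measurable borel"
proof -
  have "trunc_powr a = (\<lambda>t. if 0 < t then exp ((a - 1) * of_real (ln t)) else 0)"
    by (auto simp: trunc_powr_def fun_eq_iff powr_def Ln_of_real)
  then show ?thesis by simp
qed

lemma norm_trunc_powr: "norm (trunc_powr a t) = indicator {0<..} t * t powr (Re a - 1)"
  by (auto simp: trunc_powr_def norm_powr_real_powr indicator_def)

lemma trunc_powr_mult: "u > 0 \<Longrightarrow> trunc_powr a (u * t) = of_real u powr (a - 1) * trunc_powr a t"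
  by (auto simp: trunc_powr_def powr_times_real zero_less_mult_iff)

lemma trunc_powr_add_nat: "trunc_powr (a + of_nat n) t = of_real t ^ n * trunc_powr a t"
  by (auto simp: trunc_powr_def powr_add powr_nat' algebra_simps powr_diff)

lemma Re_pos_not_nonpos_Int: "Re a > 0 \<Longrightarrow> a \<notin> \<int>\<^sub>\<le>\<^sub>0"
  by (auto elim!: nonpos_Ints_cases)

text \<open>
  Euler's Gamma integral, carried over from the Henstock-Kurzweil to the Bochner integral, for which
  Fubini's theorem is available.
\<close>

lemma
  assumes "Re a > 0"
  shows integrable_trunc_powr_exp:
      "integrable lborel (\<lambda>t. trunc_powr a t * of_real (exp (- t)))" (is ?int)
    and integral_trunc_powr_exp:
      "(\<integral>t. trunc_powr a t * of_real (exp (- t)) \<partial>lborel) = Gamma a" (is ?eq)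
proof -
  let ?f = "\<lambda>t. complex_of_real t powr (a - 1) / of_real (exp t)"
  have eq: "(\<lambda>t. indicator {0<..} t *\<^sub>R ?f t) = (\<lambda>t. trunc_powr a t * of_real (exp (- t)))"
    by (auto simp: fun_eq_iff trunc_powr_def indicator_def exp_minus field_simps)
  have "set_integrable lebesgue {0<..} ?f"
    by (rule absolutely_integrable_Gamma_integral') fact
  then have "integrable (completion lborel) (\<lambda>t. trunc_powr a t * of_real (exp (- t)))"
    unfolding set_integrable_def eq .
  then show int: ?int by (subst (asm) integrable_completion) auto
  then have "set_integrable lborel {0<..} ?f"
    unfolding set_integrable_def eq .
  then have "(LINT t:{0<..}|lborel. ?f t) = integral {0<..} ?f"
    by (rule set_borel_integral_eq_integral)
  also have "\<dots> = Gamma a"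
    using Gamma_integral_complex'[OF assms] by (rule integral_unique)
  finally show ?eq unfolding set_lebesgue_integral_def eq .
qed

lemma trunc_powr_Beta_kernel_integrable:
  assumes "Re a > 0" "Re b > 0"
  shows "integrable lborel (\<lambda>t. trunc_powr a t * trunc_powr b (1 - t))"
proof -
  have "integrable lborel (\<lambda>t. indicator {0..1} t *\<^sub>R (t powr (Re a - 1) * (1 - t) powr (Re b - 1)))"
    using integrable_Beta[of "Re a" "Re b"] assms by (simp add: set_integrable_def)
  then show ?thesis
    by (rule Bochner_Integration.integrable_bound)
       (auto simp: norm_mult norm_trunc_powr indicator_def)
qed

text \<open>
  Substituting \<open>t \<mapsto> u t\<close> determines the convolution up to its value at \<open>1\<close>, because truncated
  powers are homogeneous.
\<close>

lemma trunc_powr_convolution_scaling: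
  assumes "u > 0"
  shows "(\<integral>t. trunc_powr a t * trunc_powr b (u - t) \<partial>lborel) =
         (\<integral>t. trunc_powr a t * trunc_powr b (1 - t) \<partial>lborel) * trunc_powr (a + b) u"
    and "Re a > 0 \<Longrightarrow> Re b > 0 \<Longrightarrow> integrable lborel (\<lambda>t. trunc_powr a t * trunc_powr b (u - t))"
proof -
  have eq: "trunc_powr a (0 + u * t) * trunc_powr b (u - (0 + u * t)) =
      of_real u powr (a - 1) * of_real u powr (b - 1) * (trunc_powr a t * trunc_powr b (1 - t))" for t
    using trunc_powr_mult[OF assms, of a t] trunc_powr_mult[OF assms, of b "1 - t"]
    by (simp add: algebra_simps)
  have "(\<integral>t. trunc_powr a t * trunc_powr b (u - t) \<partial>lborel) =
      \<bar>u\<bar> *\<^sub>R (\<integral>t. trunc_powr a (0 + u * t) * trunc_powr b (u - (0 + u * t)) \<partial>lborel)"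
    by (rule lborel_integral_real_affine) (use assms in auto)
  also have "\<dots> = (of_real u * of_real u powr (a - 1) * of_real u powr (b - 1)) *
      (\<integral>t. trunc_powr a t * trunc_powr b (1 - t) \<partial>lborel)"
    unfolding eq using assms by (simp add: scaleR_conv_of_real)
  also have "of_real u * of_real u powr (a - 1) * of_real u powr (b - 1) = trunc_powr (a + b) u"
    using assms by (simp add: trunc_powr_def powr_diff powr_add)
  finally show "(\<integral>t. trunc_powr a t * trunc_powr b (u - t) \<partial>lborel) =
         (\<integral>t. trunc_powr a t * trunc_powr b (1 - t) \<partial>lborel) * trunc_powr (a + b) u"
    by (simp add: mult.commute)
  assume "Re a > 0" "Re b > 0"
  then have "integrable lborel (\<lambda>t. trunc_powr a (0 + u * t) * trunc_powr b (u - (0 + u * t)))"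
    unfolding eq by (intro integrable_mult_right trunc_powr_Beta_kernel_integrable)
  then show "integrable lborel (\<lambda>t. trunc_powr a t * trunc_powr b (u - t))"
    using assms by (subst (asm) lborel_integrable_real_affine_iff) auto
qed

text \<open>
  Multiply the Gamma integrals of \<open>a\<close> and \<open>b\<close> and shift the second variable by the first one. By
  Fubini the product becomes the integral over \<open>u\<close> of \<open>exp (- u)\<close> times the convolution at \<open>u\<close>, hence,
  by homogeneity, the convolution at \<open>1\<close> times \<open>Gamma (a + b)\<close>.
\<close>

lemma integral_trunc_powr_Beta:
  assumes a: "Re a > 0" and b: "Re b > 0"
  shows "(\<integral>t. trunc_powr a t * trunc_powr b (1 - t) \<partial>lborel) = Beta a b"
proof -
  define B where "B = (\<integral>t. trunc_powr a t * trunc_powr b (1 - t) \<partial>lborel)"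
  define E where "E c t = trunc_powr c t * of_real (exp (- t))" for c t
  have [measurable]: "E c \<in> borel_measurable borel" for c unfolding E_def by measurable
  define h where "h = (\<lambda>(t, u). E a t * E b (u - t))"
  have iE: "integrable lborel (E c)" if "Re c > 0" for c
    using integrable_trunc_powr_exp[OF that] unfolding E_def .
  have sE: "integrable lborel (\<lambda>u. E b (u - t))" "(\<integral>u. E b (u - t) \<partial>lborel) = Gamma b"
     "(\<integral>u. norm (E b (u - t)) \<partial>lborel) = (\<integral>u. norm (E b u) \<partial>lborel)" for t
  proof -
    show "integrable lborel (\<lambda>u. E b (u - t))"
      using lborel_integrable_real_affine[OF iE[OF b], of 1 "- t"] by simp
    show "(\<integral>u. E b (u - t) \<partial>lborel) = Gamma b"
      using lborel_integral_real_affine[of 1 "E b" "- t"] integral_trunc_powr_exp[OF b]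
      by (simp add: E_def)
    show "(\<integral>u. norm (E b (u - t)) \<partial>lborel) = (\<integral>u. norm (E b u) \<partial>lborel)"
      using lborel_integral_real_affine[of 1 "\<lambda>u. norm (E b u)" "- t"] by simp
  qed
  have h: "integrable (lborel \<Otimes>\<^sub>M lborel) h"
  proof (rule lborel_pair.Fubini_integrable)
    show "h \<in> borel_measurable (lborel \<Otimes>\<^sub>M lborel)" unfolding h_def by measurable
    show "integrable lborel (\<lambda>t. \<integral>u. norm (h (t, u)) \<partial>lborel)"
      using iE[OF a] by (simp add: h_def norm_mult sE)
    show "AE t in lborel. integrable lborel (\<lambda>u. h (t, u))"
      using sE by (simp add: h_def)
  qed
  have "Gamma a * Gamma b = (\<integral>t. (\<integral>u. E a t * E b (u - t) \<partial>lborel) \<partial>lborel)"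
    using integral_trunc_powr_exp[OF a] by (simp add: sE E_def[symmetric])
  also have "\<dots> = (\<integral>u. (\<integral>t. E a t * E b (u - t) \<partial>lborel) \<partial>lborel)"
    using h unfolding h_def by (intro lborel_pair.Fubini_integral[symmetric])
  also have "\<dots> = (\<integral>u. B * E (a + b) u \<partial>lborel)"
  proof (rule Bochner_Integration.integral_cong)
    fix u :: real
    have "E a t * E b (u - t) = of_real (exp (- u)) * (trunc_powr a t * trunc_powr b (u - t))" for t
      by (simp add: E_def exp_minus exp_diff field_simps)
    then have "(\<integral>t. E a t * E b (u - t) \<partial>lborel) =
        of_real (exp (- u)) * (\<integral>t. trunc_powr a t * trunc_powr b (u - t) \<partial>lborel)" by simp
    also have "(\<integral>t. trunc_powr a t * trunc_powr b (u - t) \<partial>lborel) = B * trunc_powr (a + b) u"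
    proof (cases "u > 0")
      case True then show ?thesis unfolding B_def by (rule trunc_powr_convolution_scaling)
    next
      case False
      then have "(\<lambda>t. trunc_powr a t * trunc_powr b (u - t)) = (\<lambda>t. 0)"
        by (auto simp: trunc_powr_def)
      then show ?thesis using False by (simp add: trunc_powr_def)
    qed
    finally show "(\<integral>t. E a t * E b (u - t) \<partial>lborel) = B * E (a + b) u" by (simp add: E_def)
  qed simp
  also have "\<dots> = B * Gamma (a + b)"
    using a b integral_trunc_powr_exp[of "a + b"] by (simp add: E_def)
  finally have "Gamma a * Gamma b = B * Gamma (a + b)" .
  moreover have "a + b \<notin> \<int>\<^sub>\<le>\<^sub>0" using a b by (intro Re_pos_not_nonpos_Int) simp
  then have "Gamma (a + b) \<noteq> 0" by (simp add: Gamma_eq_zero_iff)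
  ultimately show ?thesis by (simp add: B_def Beta_def)
qed

text \<open>For \<open>u \<le> 0\<close> the supports of the two factors are disjoint and both sides vanish.\<close>

lemma
  assumes "Re a > 0" "Re b > 0"
  shows trunc_powr_convolution_integrable:
      "integrable lborel (\<lambda>t. trunc_powr a t * trunc_powr b (u - t))"
    and trunc_powr_convolution:
      "(\<integral>t. trunc_powr a t * trunc_powr b (u - t) \<partial>lborel) = Beta a b * trunc_powr (a + b) u"
proof -
  have 0: "(\<lambda>t. trunc_powr a t * trunc_powr b (u - t)) = (\<lambda>t. 0)" if "u \<le> 0"
    using that by (auto simp: trunc_powr_def)
  show "integrable lborel (\<lambda>t. trunc_powr a t * trunc_powr b (u - t))"
    using trunc_powr_convolution_scaling(2)[of u a b] 0 assms by (cases "u > 0") auto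
  show "(\<integral>t. trunc_powr a t * trunc_powr b (u - t) \<partial>lborel) = Beta a b * trunc_powr (a + b) u"
  proof (cases "u > 0")
    case True
    then show ?thesis
      using trunc_powr_convolution_scaling(1)[OF True] integral_trunc_powr_Beta[OF assms] by simp
  next
    case False
    then show ?thesis using 0 by (simp add: trunc_powr_def)
  qed
qed

section \<open>Termwise integration and binomial series\<close>

text \<open>
  The bound on \<open>g\<close> makes \<open>norm (c i) * norm (w x)\<close> a majorant that is both summable in \<open>i\<close> and
  integrable in \<open>x\<close>, so dominated convergence applies. Bounds and sums are required only where the
  weight \<open>w\<close> does not vanish, since outside its support the power series in question may diverge. The
  enumeration \<open>e\<close> reduces an unordered sum to a series over the naturals.
\<close>

lemma has_sum_integral_weighted:
  fixes w :: "'a \<Rightarrow> complex" and c :: "'i \<Rightarrow> complex" and g :: "'i \<Rightarrow> 'a \<Rightarrow> complex"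
    and e :: "nat \<Rightarrow> 'i"
  assumes w: "integrable M w" and c: "(\<lambda>i. norm (c i)) summable_on UNIV"
    and g [measurable]: "\<And>i. g i \<in> borel_measurable M"
    and le: "\<And>i x. x \<in> space M \<Longrightarrow> w x \<noteq> 0 \<Longrightarrow> norm (g i x) \<le> 1"
    and S: "\<And>x. x \<in> space M \<Longrightarrow> w x \<noteq> 0 \<Longrightarrow> ((\<lambda>i. c i * g i x) has_sum S x) UNIV"
    and e: "bij e"
  shows "integrable M (\<lambda>x. w x * S x)"
    and "((\<lambda>i. c i * (\<integral>x. w x * g i x \<partial>M)) has_sum (\<integral>x. w x * S x \<partial>M)) UNIV"
proof -
  let ?f = "\<lambda>n x. c (e n) * (w x * g (e n) x)"
  have sc: "summable (\<lambda>n. norm (c (e n)))"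
  proof -
    have "(\<lambda>n. norm (c (e n))) summable_on UNIV"
      using c e summable_on_reindex_bij_betw[of e UNIV UNIV "\<lambda>i. norm (c i)"] by auto
    then show ?thesis by (rule summable_on_imp_summable)
  qed
  have wg: "norm (w x * g i x) \<le> norm (w x)" if "x \<in> space M" for i x
    using le[OF that, of i] by (cases "w x = 0") (auto simp: norm_mult intro: mult_left_le)
  have iwg: "integrable M (\<lambda>x. w x * g i x)" for i
    using w wg by (intro Bochner_Integration.integrable_bound[OF w]) auto
  have if': "integrable M (?f n)" for n
    using iwg by (rule integrable_mult_right)
  have sf: "summable (\<lambda>n. norm (?f n x))" if "x \<in> space M" for x
  proof (rule summable_comparison_test')
    show "summable (\<lambda>n. norm (c (e n)) * norm (w x))" using sc by (rule summable_mult2)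
    show "norm (norm (?f n x)) \<le> norm (c (e n)) * norm (w x)" for n
      using wg[OF that] by (simp add: norm_mult[of "c (e n)"] mult_left_mono)
  qed
  have si: "summable (\<lambda>n. \<integral>x. norm (?f n x) \<partial>M)"
  proof (rule summable_comparison_test')
    show "summable (\<lambda>n. norm (c (e n)) * (\<integral>x. norm (w x) \<partial>M))" using sc by (rule summable_mult2)
    show "norm (\<integral>x. norm (?f n x) \<partial>M) \<le> norm (c (e n)) * (\<integral>x. norm (w x) \<partial>M)" for n
    proof -
      have "(\<integral>x. norm (w x * g (e n) x) \<partial>M) \<le> (\<integral>x. norm (w x) \<partial>M)"
        using w iwg wg by (intro integral_mono) auto
      then show ?thesis
        by (simp add: norm_mult[of "c (e n)"] mult_left_mono)
    qed
  qed
  have val: "(\<Sum>n. ?f n x) = w x * S x" if "x \<in> space M" for x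
  proof (cases "w x = 0")
    case False
    have "((\<lambda>n. c (e n) * g (e n) x) has_sum S x) UNIV"
      using S[OF that False] e has_sum_reindex_bij_betw[of e UNIV UNIV "\<lambda>i. c i * g i x"] by auto
    then have "(\<lambda>n. c (e n) * g (e n) x) sums S x" by (rule has_sum_imp_sums)
    then have "(\<lambda>n. w x * (c (e n) * g (e n) x)) sums (w x * S x)" by (rule sums_mult)
    then show ?thesis by (simp add: sums_iff mult_ac)
  qed simp
  have ae: "AE x in M. summable (\<lambda>n. norm (?f n x))" using sf by auto
  show "integrable M (\<lambda>x. w x * S x)"
    using integrable_suminf[OF if' ae si] val by (simp cong: Bochner_Integration.integrable_cong)
  have "(\<lambda>n. integral\<^sup>L M (?f n)) sums (\<integral>x. (\<Sum>n. ?f n x) \<partial>M)"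
    by (rule sums_integral[OF if' ae si])
  also have "(\<integral>x. (\<Sum>n. ?f n x) \<partial>M) = (\<integral>x. w x * S x \<partial>M)"
    using val by (intro Bochner_Integration.integral_cong) auto
  finally have "(\<lambda>n. integral\<^sup>L M (?f n)) sums (\<integral>x. w x * S x \<partial>M)" .
  moreover have "summable (\<lambda>n. norm (integral\<^sup>L M (?f n)))"
    by (rule summable_comparison_test'[OF si]) (simp only: real_norm_def abs_norm_cancel integral_norm_bound)
  ultimately have "((\<lambda>n. integral\<^sup>L M (?f n)) has_sum (\<integral>x. w x * S x \<partial>M)) UNIV"
    by (intro norm_summable_imp_has_sum)
  then have "((\<lambda>n. c (e n) * (\<integral>x. w x * g (e n) x \<partial>M)) has_sum (\<integral>x. w x * S x \<partial>M)) UNIV"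
    by simp
  then show "((\<lambda>i. c i * (\<integral>x. w x * g i x \<partial>M)) has_sum (\<integral>x. w x * S x \<partial>M)) UNIV"
    using e has_sum_reindex_bij_betw[of e UNIV UNIV "\<lambda>i. c i * (\<integral>x. w x * g i x \<partial>M)"] by auto
qed

lemma
  fixes a z :: complex
  assumes "norm z < 1"
  shows binomial_series_abs_summable: "summable (\<lambda>n. norm (pochhammer a n / fact n * z ^ n))"
    and binomial_series_has_sum:
      "((\<lambda>n. pochhammer a n / fact n * z ^ n) has_sum (1 - z) powr (- a)) UNIV"
proof -
  have eq: "(- a gchoose n) * (- z) ^ n = pochhammer a n / fact n * z ^ n" for n
  proof -
    have "(- 1) ^ n * (- z) ^ n = z ^ n"
      unfolding power_mult_distrib[symmetric] by simp
    then show ?thesis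
      by (simp add: gbinomial_pochhammer mult.left_commute[of _ "pochhammer a n"] mult.commute)
  qed
  have "ereal (norm (- z)) < conv_radius (\<lambda>n. - a gchoose n)"
    using assms by (simp add: conv_radius_gchoose)
  from abs_summable_in_conv_radius[OF this]
  show 1: "summable (\<lambda>n. norm (pochhammer a n / fact n * z ^ n))" unfolding eq .
  have "(\<lambda>n. pochhammer a n / fact n * z ^ n) sums (1 - z) powr (- a)"
    using gen_binomial_complex[of "- z" "- a"] assms unfolding eq by simp
  with 1 show "((\<lambda>n. pochhammer a n / fact n * z ^ n) has_sum (1 - z) powr (- a)) UNIV"
    by (rule norm_summable_imp_has_sum)
qed

text \<open>The next two lemmas serve to sum a double series along the lines \<open>m + n = N\<close>.\<close>

lemma antidiagonal_bij_betw:
  "bij_betw (\<lambda>(N, m). (m, N - m)) (SIGMA N:UNIV. {..N}) (UNIV :: (nat \<times> nat) set)"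
  by (rule bij_betwI[where g = "\<lambda>(m, n). (m + n, m)"]) auto

lemma antidiagonal_binomial_sum:
  fixes u v :: "'a :: field_char_0"
  shows "(\<Sum>m\<le>N. A / (fact m * fact (N - m)) * u ^ m * v ^ (N - m)) = A / fact N * (u + v) ^ N"
  by (simp add: binomial_ring binomial_fact sum_distrib_left mult_ac)

text \<open>
  Along \<open>m + n = N\<close> the binomial theorem collapses the terms to the \<open>N\<close>-th term of the binomial
  series at \<open>u + v\<close>, and the norms of the terms to the norm of the \<open>N\<close>-th term at
  \<open>norm u + norm v\<close>. The latter gives absolute convergence and so justifies the regrouping.
\<close>

lemma
  fixes a u v :: complex
  assumes uv: "norm u + norm v < 1"
  defines "f \<equiv> \<lambda>(m, n). pochhammer a (m + n) / (fact m * fact n) * u ^ m * v ^ n"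
  shows double_binomial_series_abs_summable: "(\<lambda>p. norm (f p)) summable_on UNIV"
    and double_binomial_series_has_sum: "(f has_sum (1 - u - v) powr (- a)) UNIV"
proof -
  define F where "F = (\<lambda>(N, m). f (m, N - m))"
  let ?D = "SIGMA N:(UNIV :: nat set). {..N}"
  have F: "F = f \<circ> (\<lambda>(N, m). (m, N - m))" by (auto simp: F_def)
  have Feq: "F (N, m) = pochhammer a N / (fact m * fact (N - m)) * u ^ m * v ^ (N - m)"
    if "m \<le> N" for N m using that by (simp add: F_def f_def)
  have nF: "(\<Sum>m\<le>N. norm (F (N, m))) = norm (pochhammer a N / fact N * of_real (norm u + norm v) ^ N)" for N
  proof -
    have "(\<Sum>m\<le>N. norm (F (N, m))) =
       (\<Sum>m\<le>N. norm (pochhammer a N) / (fact m * fact (N - m)) * norm u ^ m * norm v ^ (N - m))"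
      by (intro sum.cong) (auto simp: Feq norm_mult norm_divide norm_power)
    then show ?thesis unfolding antidiagonal_binomial_sum
      by (simp add: norm_mult norm_divide norm_power flip: of_real_add)
  qed
  have "(\<lambda>p. norm (F p)) summable_on ?D"
    unfolding Infinite_Sum.abs_summable_on_Sigma_iff
  proof (intro conjI ballI)
    have "summable (\<lambda>N. norm (pochhammer a N / fact N * (of_real (norm u + norm v)) ^ N))"
      using uv by (intro binomial_series_abs_summable) (simp flip: of_real_add)
    then show "(\<lambda>N. norm (\<Sum>\<^sub>\<infinity>m\<in>{..N}. norm (F (N, m)))) summable_on UNIV"
      unfolding infsum_finite[OF finite_atMost] nF
      by (intro norm_summable_imp_summable_on) simp
  qed simp
  then show abs: "(\<lambda>p. norm (f p)) summable_on UNIV"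
    using summable_on_reindex_bij_betw[OF antidiagonal_bij_betw, of "\<lambda>p. norm (f p)"]
    by (simp add: F_def case_prod_unfold)
  have sF: "(F has_sum infsum f UNIV) ?D"
    using has_sum_reindex_bij_betw[OF antidiagonal_bij_betw, of f "infsum f UNIV"]
      has_sum_infsum[OF abs_summable_summable[OF abs]]
    by (simp add: F_def case_prod_unfold)
  have in': "((\<lambda>m. F (N, m)) has_sum pochhammer a N / fact N * (u + v) ^ N) {..N}" for N
  proof (rule has_sum_finiteI)
    show "pochhammer a N / fact N * (u + v) ^ N = (\<Sum>m\<le>N. F (N, m))"
      unfolding antidiagonal_binomial_sum[symmetric] by (intro sum.cong) (auto simp: Feq)
  qed simp
  have "((\<lambda>N. pochhammer a N / fact N * (u + v) ^ N) has_sum infsum f UNIV) UNIV"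
    by (rule has_sum_SigmaD[OF sF in'])
  moreover have "norm (u + v) < 1" using uv norm_triangle_ineq[of u v] by linarith
  note binomial_series_has_sum[OF this, of a]
  ultimately have "infsum f UNIV = (1 - u - v) powr (- a)"
    using has_sum_unique by (fastforce simp: diff_diff_eq)
  then show "(f has_sum (1 - u - v) powr (- a)) UNIV"
    using has_sum_infsum[OF abs_summable_summable[OF abs]] by simp
qed

lemma
  fixes a a' u v :: complex
  assumes u: "norm u < 1" and v: "norm v < 1"
  defines "f \<equiv> \<lambda>(m, n). pochhammer a m / fact m * u ^ m * (pochhammer a' n / fact n * v ^ n)"
  shows product_binomial_series_abs_summable: "(\<lambda>p. norm (f p)) summable_on UNIV"
    and product_binomial_series_has_sum:
      "(f has_sum (1 - u) powr (- a) * (1 - v) powr (- a')) UNIV"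
proof -
  let ?g = "\<lambda>m. pochhammer a m / fact m * u ^ m" and ?h = "\<lambda>n. pochhammer a' n / fact n * v ^ n"
  have g: "(\<lambda>n. norm (?g n)) summable_on UNIV" and h: "(\<lambda>n. norm (?h n)) summable_on UNIV"
    using binomial_series_abs_summable[OF u] binomial_series_abs_summable[OF v]
    by (auto intro!: norm_summable_imp_summable_on)
  have "(\<lambda>p. norm (f p)) summable_on UNIV \<times> UNIV"
    unfolding Infinite_Sum.abs_summable_on_Sigma_iff
  proof (intro conjI ballI)
    have f: "norm (f (m, n)) = norm (?g m) * norm (?h n)" for m n
      unfolding f_def by (simp only: prod.case norm_mult)
    show "(\<lambda>n. norm (f (m, n))) summable_on UNIV" for m
      unfolding f by (rule summable_on_cmult_right[OF h])
    show "(\<lambda>m. norm (\<Sum>\<^sub>\<infinity>n. norm (f (m, n)))) summable_on UNIV"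
      unfolding f infsum_cmult_right' real_norm_def abs_mult abs_norm_cancel
      by (rule summable_on_cmult_left[OF g])
  qed
  then show "(\<lambda>p. norm (f p)) summable_on UNIV" by simp
  then have sf: "(f has_sum infsum f UNIV) (UNIV \<times> UNIV)"
    using has_sum_infsum[OF abs_summable_summable] by simp
  have "((\<lambda>n. f (m, n)) has_sum ?g m * (1 - v) powr (- a')) UNIV" for m
    unfolding f_def prod.case by (rule has_sum_cmult_right[OF binomial_series_has_sum[OF v]])
  then have "((\<lambda>m. ?g m * (1 - v) powr (- a')) has_sum infsum f UNIV) UNIV"
    by (rule has_sum_SigmaD[OF sf])
  moreover have "((\<lambda>m. ?g m * (1 - v) powr (- a')) has_sum
      (1 - u) powr (- a) * (1 - v) powr (- a')) UNIV"
    by (rule has_sum_cmult_left[OF binomial_series_has_sum[OF u]])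
  ultimately show "(f has_sum (1 - u) powr (- a) * (1 - v) powr (- a')) UNIV"
    using sf has_sum_unique by fastforce
qed

section \<open>Moments of the Beta and Dirichlet weights\<close>

lemma
  fixes f g :: "real \<Rightarrow> complex"
  assumes f: "integrable lborel f" and g: "integrable lborel g"
  shows integrable_lborel_pair_mult: "integrable (lborel \<Otimes>\<^sub>M lborel) (\<lambda>(s, t). f s * g t)" (is ?int)
    and integral_lborel_pair_mult: "(\<integral>(s, t). f s * g t \<partial>(lborel \<Otimes>\<^sub>M lborel)) =
      (\<integral>s. f s \<partial>lborel) * (\<integral>t. g t \<partial>lborel)"
proof -
  have [measurable]: "f \<in> borel_measurable borel" "g \<in> borel_measurable borel"
    using f g by (auto dest: borel_measurable_integrable)
  show int: ?int
    by (rule lborel_pair.Fubini_integrable) (use f g in \<open>auto simp: norm_mult\<close>)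
  then show "(\<integral>(s, t). f s * g t \<partial>(lborel \<Otimes>\<^sub>M lborel)) = (\<integral>s. f s \<partial>lborel) * (\<integral>t. g t \<partial>lborel)"
    using lborel_pair.integral_fst[OF int] f g by simp
qed

text \<open>
  The norm of a truncated power is a truncated power again, so that convolution identities also
  compute the integrals of norms that Fubini's theorem asks for.
\<close>

lemma of_real_norm_trunc_powr: "of_real (norm (trunc_powr a t)) = trunc_powr (of_real (Re a)) t"
  using powr_of_real[of t "Re a - 1"] by (simp add: trunc_powr_def norm_powr_real_powr)

text \<open>
  Integrating over \<open>s\<close> is a convolution evaluated at \<open>1 - t\<close>, after which integrating over \<open>t\<close> is a
  convolution evaluated at \<open>1\<close>.
\<close>

lemma
  assumes a: "Re a > 0" and b: "Re b > 0" and c: "Re c > 0"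
  defines "w \<equiv> \<lambda>(t, s). trunc_powr a t * trunc_powr b s * trunc_powr c (1 - t - s)"
  shows Dirichlet_kernel_integrable: "integrable (lborel \<Otimes>\<^sub>M lborel) w" (is ?int)
    and Dirichlet_integral:
      "(\<integral>p. w p \<partial>(lborel \<Otimes>\<^sub>M lborel)) = Gamma a * Gamma b * Gamma c / Gamma (a + b + c)"
proof -
  let ?r = "\<lambda>z. complex_of_real (Re z)"
  let ?K = "Beta (?r b) (?r c)"
  have w: "w (t, s) = trunc_powr a t * (trunc_powr b s * trunc_powr c ((1 - t) - s))" for t s
    by (simp add: w_def)
  \<comment> \<open>Taking norms replaces the parameters by their real parts, so the convolution identity still applies.\<close>
  have nw: "(\<integral>s. norm (w (t, s)) \<partial>lborel) =
      Re (?K * (trunc_powr (?r a) t * trunc_powr (?r b + ?r c) (1 - t)))" for t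
  proof -
    have "complex_of_real (\<integral>s. norm (w (t, s)) \<partial>lborel) =
       (\<integral>s. trunc_powr (?r a) t * (trunc_powr (?r b) s * trunc_powr (?r c) ((1 - t) - s)) \<partial>lborel)"
      unfolding w norm_mult integral_complex_of_real[symmetric] of_real_mult of_real_norm_trunc_powr ..
    also have "\<dots> = ?K * (trunc_powr (?r a) t * trunc_powr (?r b + ?r c) (1 - t))"
      using b c by (simp add: trunc_powr_convolution)
    finally show ?thesis by (metis Re_complex_of_real)
  qed
  show int: ?int
  proof (rule lborel_pair.Fubini_integrable)
    show "w \<in> borel_measurable (lborel \<Otimes>\<^sub>M lborel)" unfolding w_def by measurable
    show "integrable lborel (\<lambda>t. \<integral>s. norm (w (t, s)) \<partial>lborel)"
      unfolding nw using a b c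
      by (intro integrable_Re integrable_mult_right trunc_powr_convolution_integrable) auto
    show "AE t in lborel. integrable lborel (\<lambda>s. w (t, s))"
      unfolding w using b c trunc_powr_convolution_integrable by simp
  qed
  have "(\<integral>p. w p \<partial>(lborel \<Otimes>\<^sub>M lborel)) = (\<integral>t. (\<integral>s. w (t, s) \<partial>lborel) \<partial>lborel)"
    by (rule lborel_pair.integral_fst'[OF int, symmetric])
  also have "\<dots> = (\<integral>t. Beta b c * (trunc_powr a t * trunc_powr (b + c) (1 - t)) \<partial>lborel)"
    unfolding w using b c by (simp add: trunc_powr_convolution mult_ac)
  also have "\<dots> = Beta b c * Beta a (b + c)"
    using a b c by (simp add: integral_trunc_powr_Beta)
  also have "\<dots> = Gamma a * Gamma b * Gamma c / Gamma (a + b + c)"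
    using b c Re_pos_not_nonpos_Int[of "b + c"] by (simp add: Beta_def Gamma_eq_zero_iff add.assoc)
  finally show "(\<integral>p. w p \<partial>(lborel \<Otimes>\<^sub>M lborel)) = Gamma a * Gamma b * Gamma c / Gamma (a + b + c)" .
qed

lemma Gamma_add_nat:
  fixes z :: complex
  assumes "Re z > 0"
  shows "Gamma (z + of_nat n) = Gamma z * pochhammer z n"
proof -
  have "z \<notin> \<int>\<^sub>\<le>\<^sub>0" using assms by (rule Re_pos_not_nonpos_Int)
  moreover from this have "Gamma z \<noteq> 0" by (simp add: Gamma_eq_zero_iff)
  ultimately show ?thesis using pochhammer_Gamma[of z n] by (simp add: divide_simps mult.commute)
qed

text \<open>
  Multiplying a truncated power by \<open>t\<^sup>m\<close> raises its parameter by \<open>m\<close>, so moments are Beta and Dirichlet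
  integrals with shifted parameters.
\<close>

lemma Beta_moment:
  assumes "Re b > 0" "Re d > 0"
  shows "(\<integral>t. trunc_powr b t * trunc_powr d (1 - t) * of_real t ^ m \<partial>lborel) =
    Beta b d * (pochhammer b m / pochhammer (b + d) m)"
proof -
  have "(\<integral>t. trunc_powr b t * trunc_powr d (1 - t) * of_real t ^ m \<partial>lborel) =
     (\<integral>t. trunc_powr (b + of_nat m) t * trunc_powr d (1 - t) \<partial>lborel)"
    by (simp add: trunc_powr_add_nat mult_ac)
  also have "\<dots> = Beta (b + of_nat m) d"
    using assms by (intro integral_trunc_powr_Beta) auto
  also have "\<dots> = Gamma (b + of_nat m) * Gamma d / Gamma ((b + d) + of_nat m)"
    by (simp add: Beta_def add_ac)
  also have "\<dots> = Beta b d * (pochhammer b m / pochhammer (b + d) m)"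
    using assms by (simp only: Gamma_add_nat plus_complex.sel add_pos_pos) (simp add: Beta_def)
  finally show ?thesis .
qed

lemma Dirichlet_moment:
  assumes "Re b > 0" "Re b' > 0" "Re d > 0"
  shows "(\<integral>(t, s). trunc_powr b t * trunc_powr b' s * trunc_powr d (1 - t - s) *
        (of_real t ^ m * of_real s ^ n) \<partial>(lborel \<Otimes>\<^sub>M lborel)) =
    Gamma b * Gamma b' * Gamma d / Gamma (b + b' + d) *
    (pochhammer b m * pochhammer b' n / pochhammer (b + b' + d) (m + n))"
proof -
  have "(\<integral>(t, s). trunc_powr b t * trunc_powr b' s * trunc_powr d (1 - t - s) *
        (of_real t ^ m * of_real s ^ n) \<partial>(lborel \<Otimes>\<^sub>M lborel)) =
     (\<integral>(t, s). trunc_powr (b + of_nat m) t * trunc_powr (b' + of_nat n) s * trunc_powr d (1 - t - s)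
        \<partial>(lborel \<Otimes>\<^sub>M lborel))"
    by (simp add: trunc_powr_add_nat mult_ac)
  also have "\<dots> = Gamma (b + of_nat m) * Gamma (b' + of_nat n) * Gamma d /
      Gamma ((b + of_nat m) + (b' + of_nat n) + d)"
    using assms by (intro Dirichlet_integral) auto
  also have "(b + of_nat m) + (b' + of_nat n) + d = (b + b' + d) + of_nat (m + n)" by simp
  finally show ?thesis
    using assms by (simp only: Gamma_add_nat plus_complex.sel add_pos_pos) (simp add: mult_ac)
qed

section \<open>Euler integrals for the Appell functions\<close>

text \<open>
  In both parts the parameters \<open>d\<close> and \<open>d'\<close> stand for the differences of the classical ones:
  \<open>\<gamma> - \<beta>\<close> and \<open>\<gamma>' - \<beta>'\<close> for \<open>F\<^sub>2\<close>, and \<open>\<gamma> - \<beta> - \<beta>'\<close> for \<open>F\<^sub>3\<close>, so that their real parts are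
  positive. In the kernel of \<open>F\<^sub>2\<close> the outer variable \<open>s\<close> of the iterated integral comes first.
\<close>

definition Appell_F2_kernel where
  "Appell_F2_kernel a b b' d d' u v = (\<lambda>(s, t).
     (trunc_powr b' s * trunc_powr d' (1 - s)) * (trunc_powr b t * trunc_powr d (1 - t)) *
     (1 - u * of_real t - v * of_real s) powr (- a))"

text \<open>
  Here \<open>w\<close> is the product of two Beta weights and \<open>c\<close> holds the coefficients of the double binomial
  series of \<open>(1 - u t - v s)\<^sup>-\<^sup>a\<close>, which converges because \<open>t\<close> and \<open>s\<close> do not exceed \<open>1\<close> on the support
  of \<open>w\<close>. Fubini's theorem needs the integrability of the kernel to pass to the iterated integral.
\<close>

lemma
  assumes b: "Re b > 0" and d: "Re d > 0" and b': "Re b' > 0" and d': "Re d' > 0"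
    and uv: "norm u + norm v < 1"
  shows Appell_F2_kernel_integrable:
      "integrable (lborel \<Otimes>\<^sub>M lborel) (Appell_F2_kernel a b b' d d' u v)"
    and Appell_F2_has_sum:
      "((\<lambda>(m, n). pochhammer a (m + n) * pochhammer b m * pochhammer b' n /
           (pochhammer (b + d) m * pochhammer (b' + d') n) * (u ^ m / fact m) * (v ^ n / fact n))
        has_sum (\<integral>p. Appell_F2_kernel a b b' d d' u v p \<partial>(lborel \<Otimes>\<^sub>M lborel)) /
          (Beta b d * Beta b' d')) UNIV"
proof -
  define w where "w = (\<lambda>(s, t). (trunc_powr b' s * trunc_powr d' (1 - s)) *
     (trunc_powr b t * trunc_powr d (1 - t)))"
  define c where "c = (\<lambda>(m, n). pochhammer a (m + n) / (fact m * fact n) * u ^ m * v ^ n)"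
  define g :: "nat \<times> nat \<Rightarrow> real \<times> real \<Rightarrow> complex"
    where "g = (\<lambda>(m, n) (s, t). of_real s ^ n * of_real t ^ m)"
  define S where "S = (\<lambda>(s, t). (1 - u * of_real t - v * of_real s) powr (- a))"
  have kernel: "Appell_F2_kernel a b b' d d' u v = (\<lambda>p. w p * S p)"
    by (auto simp: Appell_F2_kernel_def w_def S_def fun_eq_iff)
  have w: "integrable (lborel \<Otimes>\<^sub>M lborel) w"
    unfolding w_def using b d b' d'
    by (intro integrable_lborel_pair_mult trunc_powr_convolution_integrable)
  have supp: "0 < s" "s < 1" "0 < t" "t < 1" if "w (s, t) \<noteq> 0" for s t
    using that by (auto simp: w_def trunc_powr_def split: if_splits)
  have g: "g i \<in> borel_measurable (lborel \<Otimes>\<^sub>M lborel)" for i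
    unfolding g_def by (cases i) simp
  have le: "norm (g i p) \<le> 1" if "w p \<noteq> 0" for i p
  proof -
    obtain m n s t where [simp]: "i = (m, n)" "p = (s, t)" by (metis surj_pair)
    show ?thesis using supp[of s t] that
      by (auto simp: g_def norm_mult norm_power intro!: mult_le_one power_le_one)
  qed
  have c: "(\<lambda>i. norm (c i)) summable_on UNIV"
    unfolding c_def by (rule double_binomial_series_abs_summable[OF uv])
  have S: "((\<lambda>i. c i * g i p) has_sum S p) UNIV" if "w p \<noteq> 0" for p
  proof -
    obtain s t where p [simp]: "p = (s, t)" by (metis surj_pair)
    have st: "0 < s" "s < 1" "0 < t" "t < 1" using supp[of s t] that by auto
    have "norm (u * of_real t) + norm (v * of_real s) \<le> norm u + norm v"
      using st by (intro add_mono) (auto simp: norm_mult intro: mult_left_le)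
    then have "norm (u * of_real t) + norm (v * of_real s) < 1" using uv by simp
    from double_binomial_series_has_sum[OF this, of a] show ?thesis
      by (simp add: c_def g_def S_def power_mult_distrib mult_ac case_prod_unfold)
  qed
  have moment: "(\<integral>p. w p * g (m, n) p \<partial>(lborel \<Otimes>\<^sub>M lborel)) =
      Beta b' d' * (pochhammer b' n / pochhammer (b' + d') n) *
      (Beta b d * (pochhammer b m / pochhammer (b + d) m))" for m n
  proof -
    have int: "integrable lborel (\<lambda>t. trunc_powr b t * trunc_powr d (1 - t) * of_real t ^ m)"
      if "Re b > 0" "Re d > 0" for b d m
      using trunc_powr_convolution_integrable[of "b + of_nat m" d 1] that
      by (simp add: trunc_powr_add_nat mult_ac)
    have "(\<integral>p. w p * g (m, n) p \<partial>(lborel \<Otimes>\<^sub>M lborel)) =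
      (\<integral>(s, t). (trunc_powr b' s * trunc_powr d' (1 - s) * of_real s ^ n) *
          (trunc_powr b t * trunc_powr d (1 - t) * of_real t ^ m) \<partial>(lborel \<Otimes>\<^sub>M lborel))"
      by (intro Bochner_Integration.integral_cong) (auto simp: w_def g_def mult_ac)
    also have "\<dots> = (\<integral>s. trunc_powr b' s * trunc_powr d' (1 - s) * of_real s ^ n \<partial>lborel) *
      (\<integral>t. trunc_powr b t * trunc_powr d (1 - t) * of_real t ^ m \<partial>lborel)"
      by (intro integral_lborel_pair_mult int b d b' d')
    finally show ?thesis by (simp only: Beta_moment b d b' d')
  qed
  note * = has_sum_integral_weighted[OF w c g le S bij_prod_decode]
  show "integrable (lborel \<Otimes>\<^sub>M lborel) (Appell_F2_kernel a b b' d d' u v)"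
    unfolding kernel by (rule *(1))
  have nz: "Beta b d * Beta b' d' \<noteq> 0"
    using b d b' d' by (simp add: Beta_def Gamma_eq_zero_iff Re_pos_not_nonpos_Int)
  have "((\<lambda>i. c i * (\<integral>p. w p * g i p \<partial>(lborel \<Otimes>\<^sub>M lborel)) / (Beta b d * Beta b' d')) has_sum
     (\<integral>p. w p * S p \<partial>(lborel \<Otimes>\<^sub>M lborel)) / (Beta b d * Beta b' d')) UNIV"
    using *(2) by (intro has_sum_divide_const)
  also have "(\<lambda>i. c i * (\<integral>p. w p * g i p \<partial>(lborel \<Otimes>\<^sub>M lborel)) / (Beta b d * Beta b' d')) =
     (\<lambda>(m, n). pochhammer a (m + n) * pochhammer b m * pochhammer b' n /
           (pochhammer (b + d) m * pochhammer (b' + d') n) * (u ^ m / fact m) * (v ^ n / fact n))"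
    using nz by (auto simp: moment c_def fun_eq_iff divide_simps)
  finally show "((\<lambda>(m, n). pochhammer a (m + n) * pochhammer b m * pochhammer b' n /
           (pochhammer (b + d) m * pochhammer (b' + d') n) * (u ^ m / fact m) * (v ^ n / fact n))
        has_sum (\<integral>p. Appell_F2_kernel a b b' d d' u v p \<partial>(lborel \<Otimes>\<^sub>M lborel)) /
          (Beta b d * Beta b' d')) UNIV"
    unfolding kernel .
qed

definition Appell_F3_kernel where
  "Appell_F3_kernel a a' b b' d u v = (\<lambda>(t, s).
     trunc_powr b t * trunc_powr b' s * trunc_powr d (1 - t - s) *
     ((1 - u * of_real t) powr (- a) * (1 - v * of_real s) powr (- a')))"

text \<open>
  The same argument with the Dirichlet weight and the product of two binomial series. The series
  needs \<open>norm u\<close> and \<open>norm v\<close> below \<open>1\<close> separately because the two binomials do not share a variable.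
\<close>

lemma Appell_F3_has_sum:
  assumes b: "Re b > 0" and b': "Re b' > 0" and d: "Re d > 0"
    and u: "norm u < 1" and v: "norm v < 1"
  shows "((\<lambda>(m, n). pochhammer a m * pochhammer a' n * pochhammer b m * pochhammer b' n /
           pochhammer (b + b' + d) (m + n) * (u ^ m / fact m) * (v ^ n / fact n))
        has_sum Gamma (b + b' + d) / (Gamma b * Gamma b' * Gamma d) *
          (\<integral>p. Appell_F3_kernel a a' b b' d u v p \<partial>(lborel \<Otimes>\<^sub>M lborel))) UNIV"
proof -
  define w where "w = (\<lambda>(t, s). trunc_powr b t * trunc_powr b' s * trunc_powr d (1 - t - s))"
  define c where "c = (\<lambda>(m, n). pochhammer a m / fact m * u ^ m * (pochhammer a' n / fact n * v ^ n))"
  define g :: "nat \<times> nat \<Rightarrow> real \<times> real \<Rightarrow> complex"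
    where "g = (\<lambda>(m, n) (t, s). of_real t ^ m * of_real s ^ n)"
  define S where "S = (\<lambda>(t, s). (1 - u * of_real t) powr (- a) * (1 - v * of_real s) powr (- a'))"
  have kernel: "Appell_F3_kernel a a' b b' d u v = (\<lambda>p. w p * S p)"
    by (auto simp: Appell_F3_kernel_def w_def S_def fun_eq_iff)
  have w: "integrable (lborel \<Otimes>\<^sub>M lborel) w"
    unfolding w_def using b b' d by (rule Dirichlet_kernel_integrable)
  have supp: "0 < t" "t < 1" "0 < s" "s < 1" if "w (t, s) \<noteq> 0" for t s
    using that by (auto simp: w_def trunc_powr_def split: if_splits)
  have g: "g i \<in> borel_measurable (lborel \<Otimes>\<^sub>M lborel)" for i
    unfolding g_def by (cases i) simp
  have le: "norm (g i p) \<le> 1" if "w p \<noteq> 0" for i p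
  proof -
    obtain m n s t where [simp]: "i = (m, n)" "p = (t, s)" by (metis surj_pair)
    show ?thesis using supp[of t s] that
      by (auto simp: g_def norm_mult norm_power intro!: mult_le_one power_le_one)
  qed
  have c: "(\<lambda>i. norm (c i)) summable_on UNIV"
    unfolding c_def by (rule product_binomial_series_abs_summable[OF u v])
  have S: "((\<lambda>i. c i * g i p) has_sum S p) UNIV" if "w p \<noteq> 0" for p
  proof -
    obtain s t where p [simp]: "p = (t, s)" by (metis surj_pair)
    have st: "0 < s" "s < 1" "0 < t" "t < 1" using supp[of t s] that by auto
    have "norm (u * of_real t) \<le> norm u" "norm (v * of_real s) \<le> norm v"
      using st by (auto simp: norm_mult intro: mult_left_le)
    then have "norm (u * of_real t) < 1" "norm (v * of_real s) < 1" using u v by auto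
    from product_binomial_series_has_sum[OF this, of a a'] show ?thesis
      by (simp add: c_def g_def S_def power_mult_distrib mult_ac case_prod_unfold)
  qed
  let ?G = "Gamma b * Gamma b' * Gamma d" and ?c = "b + b' + d"
  have moment: "(\<integral>p. w p * g (m, n) p \<partial>(lborel \<Otimes>\<^sub>M lborel)) =
      ?G / Gamma ?c * (pochhammer b m * pochhammer b' n / pochhammer ?c (m + n))" for m n
    using Dirichlet_moment[OF b b' d, of m n] by (simp add: w_def g_def case_prod_unfold)
  note * = has_sum_integral_weighted(2)[OF w c g le S bij_prod_decode]
  have nz: "?G \<noteq> 0" "Gamma ?c \<noteq> 0"
    using b b' d by (simp_all add: Gamma_eq_zero_iff Re_pos_not_nonpos_Int)
  have "((\<lambda>i. Gamma ?c / ?G * (c i * (\<integral>p. w p * g i p \<partial>(lborel \<Otimes>\<^sub>M lborel)))) has_sum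
     Gamma ?c / ?G * (\<integral>p. w p * S p \<partial>(lborel \<Otimes>\<^sub>M lborel))) UNIV"
    using * by (intro has_sum_cmult_right)
  also have "(\<lambda>i. Gamma ?c / ?G * (c i * (\<integral>p. w p * g i p \<partial>(lborel \<Otimes>\<^sub>M lborel)))) =
     (\<lambda>(m, n). pochhammer a m * pochhammer a' n * pochhammer b m * pochhammer b' n /
           pochhammer ?c (m + n) * (u ^ m / fact m) * (v ^ n / fact n))"
    using nz by (auto simp: moment c_def fun_eq_iff divide_simps)
  finally show ?thesis unfolding kernel .
qed

section \<open>Transfer to the \<open>k\<close>-functions\<close>

lemma k_Beta_conv_Beta:
  assumes "k > 0" "Re x > 0" "Re y > 0"
  shows "k_Beta k x y = Beta (x / of_real k) (y / of_real k) / of_real k"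
proof -
  have "(LBINT t=0..1. of_real t powr (x / of_real k - 1) * of_real (1 - t) powr (y / of_real k - 1)) =
      (\<integral>t. trunc_powr (x / of_real k) t * trunc_powr (y / of_real k) (1 - t) \<partial>lborel)"
    by (auto simp: interval_lebesgue_integral_def set_lebesgue_integral_def einterval_iff
        trunc_powr_def indicator_def intro!: Bochner_Integration.integral_cong)
  with assms show ?thesis by (simp add: k_Beta_def integral_trunc_powr_Beta)
qed

text \<open>Substitute \<open>t\<^sup>k / k\<close> for the integration variable of the Gamma integral.\<close>

lemma k_Gamma_conv_Gamma:
  assumes k: "k > 0" and x: "Re x > 0"
  shows "k_Gamma k x = of_real k powr (x / of_real k - 1) * Gamma (x / of_real k)"
proof -
  define z where "z = x / of_real k"
  have z: "Re z > 0" using assms by (simp add: z_def)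
  let ?f = "\<lambda>t. complex_of_real t powr (z - 1) / of_real (exp t)"
  let ?g = "\<lambda>t. t powr k / k"
  let ?h = "\<lambda>t. complex_of_real t powr (x - 1) * of_real (exp (- (t powr k) / k))"
  have img: "?g ` {0<..} = {0<..}"
  proof (intro equalityI subsetI)
    fix u :: real assume "u \<in> {0<..}"
    then show "u \<in> ?g ` {0<..}"
      using k by (intro image_eqI[of _ _ "(k * u) powr (1 / k)"]) (auto simp: powr_powr)
  qed (use k in auto)
  have inj: "inj_on ?g {0<..}"
    using k by (intro inj_on_inverseI[where g = "\<lambda>u. (k * u) powr (1 / k)"]) (auto simp: powr_powr)
  have "?f absolutely_integrable_on ?g ` {0<..} \<and> integral (?g ` {0<..}) ?f = Gamma z"
    using absolutely_integrable_Gamma_integral'[OF z]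
      integral_unique[OF Gamma_integral_complex'[OF z]] unfolding img by simp
  then have cv: "(\<lambda>t. \<bar>t powr (k - 1)\<bar> *\<^sub>R ?f (?g t)) absolutely_integrable_on {0<..} \<and>
      integral {0<..} (\<lambda>t. \<bar>t powr (k - 1)\<bar> *\<^sub>R ?f (?g t)) = Gamma z"
    using k inj
    by (subst has_absolute_integral_change_of_variables_real[where g = ?g])
       (auto intro!: derivative_eq_intros)
  have eq: "\<bar>t powr (k - 1)\<bar> *\<^sub>R ?f (?g t) = of_real k powr (1 - z) * ?h t" if "t > 0" for t
  proof -
    \<comment> \<open>All powers become exponentials of linear combinations of \<open>ln t\<close> and \<open>ln k\<close>, to be compared.\<close>
    have "complex_of_real (?g t) powr (z - 1) = exp ((z - 1) * of_real (k * ln t - ln k))"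
      using that k by (simp add: powr_def Ln_of_real ln_div ln_powr del: of_real_divide)
    moreover have "complex_of_real (t powr (k - 1)) = exp (of_real ((k - 1) * ln t))"
      using that by (simp add: powr_def flip: exp_of_real)
    moreover have "(z - 1) * of_real (k * ln t - ln k) + of_real ((k - 1) * ln t) =
       (1 - z) * of_real (ln k) + (x - 1) * of_real (ln t)"
      using k by (simp add: z_def field_simps)
    ultimately have "complex_of_real (t powr (k - 1)) * of_real (?g t) powr (z - 1) =
       of_real k powr (1 - z) * of_real t powr (x - 1)"
      using that k by (simp add: powr_def Ln_of_real flip: exp_add) (simp add: add.commute)
    then show ?thesis
      by (simp add: scaleR_conv_of_real exp_minus divide_simps)
  qed
  let ?F = "\<lambda>t. of_real k powr (1 - z) * ?h t"
  have abs: "?F absolutely_integrable_on {0<..}"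
    using cv by (subst set_integrable_cong[OF refl refl eq[symmetric]]) auto
  have int: "integral {0<..} ?F = Gamma z"
    using cv by (subst integral_cong[OF eq[symmetric]]) auto
  have ind: "(\<lambda>t. indicator {0<..} t *\<^sub>R ?F t) =
     (\<lambda>t. of_real k powr (1 - z) * (trunc_powr x t * of_real (exp (- (t powr k) / k))))"
    by (auto simp: fun_eq_iff trunc_powr_def indicator_def)
  have "set_integrable lborel {0<..} ?F"
    using abs unfolding set_integrable_def ind by (subst (asm) integrable_completion) auto
  then have "(LINT t:{0<..}|lborel. ?F t) = Gamma z"
    using int by (subst set_borel_integral_eq_integral) auto
  then have "of_real k powr (1 - z) * k_Gamma k x = Gamma z"
    by (simp add: k_Gamma_def interval_lebesgue_integral_0_infty)
  moreover have "of_real k powr (z - 1) * of_real k powr (1 - z) = (1 :: complex)"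
    using k by (simp flip: powr_add)
  ultimately show ?thesis
    unfolding z_def[symmetric] by (metis mult.assoc mult.left_neutral)
qed

lemma k_pochhammer_conv_pochhammer:
  assumes "k > 0"
  shows "k_pochhammer k a n = of_real k ^ n * pochhammer (a / of_real k) n"
proof -
  have "k_pochhammer k a n = (\<Prod>i<n. of_real k * (a / of_real k + of_nat i))"
    unfolding k_pochhammer_def using assms by (intro prod.cong) (auto simp: field_simps)
  then show ?thesis
    by (simp add: prod.distrib pochhammer_prod atLeast0LessThan)
qed

text \<open>
  The factors \<open>1 / k\<close> of the two \<open>k\<close>-Beta functions cancel against \<open>k\<^sup>2\<close>; on the open unit square the
  kernel agrees with the given integrand.
\<close>

lemma k_Appell_F2_eq:
  assumes k: "k > 0"
    and re: "Re \<gamma> > Re \<beta>" "Re \<beta> > 0" "Re \<gamma>' > Re \<beta>'" "Re \<beta>' > 0"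
    and xy: "norm x + norm y < 1 / k"
  shows "k_Appell_F2 k \<alpha> \<beta> \<beta>' \<gamma> \<gamma>' x y =
          1 / (of_real k ^ 2 * k_Beta k \<beta> (\<gamma> - \<beta>) * k_Beta k \<beta>' (\<gamma>' - \<beta>')) *
          (LBINT s=0..1. (LBINT t=0..1.
             of_real t powr (\<beta> / of_real k - 1) * of_real s powr (\<beta>' / of_real k - 1) *
             of_real (1 - t) powr ((\<gamma> - \<beta>) / of_real k - 1) *
             of_real (1 - s) powr ((\<gamma>' - \<beta>') / of_real k - 1) /
             (1 - of_real k * x * of_real t - of_real k * y * of_real s) powr (\<alpha> / of_real k)))"
proof -
  let ?k = "complex_of_real k"
  define a b b' d d' where "a = \<alpha> / ?k" and "b = \<beta> / ?k" and "b' = \<beta>' / ?k"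
    and "d = (\<gamma> - \<beta>) / ?k" and "d' = (\<gamma>' - \<beta>') / ?k"
  define u v where "u = ?k * x" and "v = ?k * y"
  have pos: "Re b > 0" "Re d > 0" "Re b' > 0" "Re d' > 0"
    using k re by (simp_all add: b_def d_def b'_def d'_def)
  have sum: "\<gamma> / ?k = b + d" "\<gamma>' / ?k = b' + d'"
    using k by (simp_all add: b_def d_def b'_def d'_def diff_divide_distrib)
  have uv: "norm u + norm v < 1"
    using xy k by (simp add: u_def v_def norm_mult field_simps)
  define f where "f = Appell_F2_kernel a b b' d d' u v"
  have "k_Appell_F2 k \<alpha> \<beta> \<beta>' \<gamma> \<gamma>' x y =
    (\<Sum>\<^sub>\<infinity>(m, n)\<in>UNIV. pochhammer a (m + n) * pochhammer b m * pochhammer b' n /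
           (pochhammer (b + d) m * pochhammer (b' + d') n) * (u ^ m / fact m) * (v ^ n / fact n))"
    unfolding k_Appell_F2_def k_pochhammer_conv_pochhammer[OF k] sum
    using k by (simp add: a_def[symmetric] b_def[symmetric] b'_def[symmetric] u_def v_def
        power_add power_mult_distrib field_simps)
  also have "\<dots> = (\<integral>p. f p \<partial>(lborel \<Otimes>\<^sub>M lborel)) / (Beta b d * Beta b' d')"
    unfolding f_def by (intro infsumI Appell_F2_has_sum pos uv)
  also have "(\<integral>p. f p \<partial>(lborel \<Otimes>\<^sub>M lborel)) = (\<integral>s. (\<integral>t. f (s, t) \<partial>lborel) \<partial>lborel)"
    unfolding f_def by (intro lborel_pair.integral_fst'[symmetric] Appell_F2_kernel_integrable pos uv)
  also have "\<dots> = (LBINT s=0..1. (LBINT t=0..1. f (s, t)))"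
  proof -
    \<comment> \<open>For \<open>s\<close> outside the open unit interval the kernel vanishes identically in \<open>t\<close>.\<close>
    have "(\<integral>t. f (s, t) \<partial>lborel) = indicator {0<..<1} s *\<^sub>R (LBINT t=0..1. f (s, t))" for s
      by (auto simp: f_def Appell_F2_kernel_def interval_lebesgue_integral_def
          set_lebesgue_integral_def einterval_iff trunc_powr_def indicator_def
          intro!: Bochner_Integration.integral_cong)
    moreover have "einterval 0 1 = {0<..<1}" by (auto simp: einterval_iff)
    ultimately show ?thesis
      by (simp add: interval_lebesgue_integral_def[of _ 0 1 "\<lambda>s. LBINT t=0..1. f (s, t)"]
          set_lebesgue_integral_def)
  qed
  also have "\<dots> = (LBINT s=0..1. (LBINT t=0..1.
             of_real t powr (b - 1) * of_real s powr (b' - 1) *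
             of_real (1 - t) powr (d - 1) * of_real (1 - s) powr (d' - 1) /
             (1 - u * of_real t - v * of_real s) powr a))"
    by (intro interval_lebesgue_integral_cong)
       (auto simp: f_def Appell_F2_kernel_def trunc_powr_def einterval_iff powr_minus field_simps)
  also have "Beta b d * Beta b' d' = ?k ^ 2 * k_Beta k \<beta> (\<gamma> - \<beta>) * k_Beta k \<beta>' (\<gamma>' - \<beta>')"
    using k re by (simp add: k_Beta_conv_Beta b_def d_def b'_def d'_def power2_eq_square)
  finally show ?thesis
    unfolding a_def b_def b'_def d_def d'_def u_def v_def by simp
qed

text \<open>
  The powers of \<open>k\<close> in the four \<open>k\<close>-Gamma functions cancel against \<open>k\<^sup>2\<close>. The integrands agree
  pointwise even on the boundary of the simplex: \<open>0 powr z = 0\<close> and division by zero yields zero,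
  so both are zero there.
\<close>

lemma k_Appell_F3_eq:
  assumes k: "k > 0"
    and re: "Re \<beta> > 0" "Re \<beta>' > 0" "Re (\<gamma> - \<beta> - \<beta>') > 0"
    and xy: "norm x < 1 / k" "norm y < 1 / k"
  shows "k_Appell_F3 k \<alpha> \<alpha>' \<beta> \<beta>' \<gamma> x y =
          k_Gamma k \<gamma> /
          (of_real k ^ 2 * k_Gamma k \<beta> * k_Gamma k \<beta>' * k_Gamma k (\<gamma> - \<beta> - \<beta>')) *
          set_lebesgue_integral lborel {(t, s). t \<ge> 0 \<and> s \<ge> 0 \<and> t + s \<le> 1}
            (\<lambda>(t :: real, s :: real).
               of_real t powr (\<beta> / of_real k - 1) * of_real s powr (\<beta>' / of_real k - 1) *
               (1 - of_real k * x * of_real t) powr (- \<alpha> / of_real k) *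
               (1 - of_real k * y * of_real s) powr (- \<alpha>' / of_real k) /
               of_real (1 - t - s) powr (1 - (\<gamma> - \<beta> - \<beta>') / of_real k))"
proof -
  let ?k = "complex_of_real k"
  define a a' b b' d where "a = \<alpha> / ?k" and "a' = \<alpha>' / ?k" and "b = \<beta> / ?k" and "b' = \<beta>' / ?k"
    and "d = (\<gamma> - \<beta> - \<beta>') / ?k"
  define u v where "u = ?k * x" and "v = ?k * y"
  have pos: "Re b > 0" "Re b' > 0" "Re d > 0"
    using k re by (simp_all add: b_def b'_def d_def)
  have sum: "\<gamma> / ?k = b + b' + d"
    using k by (simp add: b_def d_def b'_def diff_divide_distrib)
  have uv: "norm u < 1" "norm v < 1"
    using xy k by (simp_all add: u_def v_def norm_mult field_simps)
  define f where "f = Appell_F3_kernel a a' b b' d u v"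
  have "k_Appell_F3 k \<alpha> \<alpha>' \<beta> \<beta>' \<gamma> x y =
    (\<Sum>\<^sub>\<infinity>(m, n)\<in>UNIV. pochhammer a m * pochhammer a' n * pochhammer b m * pochhammer b' n /
           pochhammer (b + b' + d) (m + n) * (u ^ m / fact m) * (v ^ n / fact n))"
    unfolding k_Appell_F3_def k_pochhammer_conv_pochhammer[OF k] sum
    using k by (simp add: a_def[symmetric] a'_def[symmetric] b_def[symmetric] b'_def[symmetric]
        u_def v_def power_add power_mult_distrib field_simps)
  also have "\<dots> = Gamma (b + b' + d) / (Gamma b * Gamma b' * Gamma d) *
      (\<integral>p. f p \<partial>(lborel \<Otimes>\<^sub>M lborel))"
    unfolding f_def by (intro infsumI Appell_F3_has_sum pos uv)
  also have "(\<integral>p. f p \<partial>(lborel \<Otimes>\<^sub>M lborel)) =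
      set_lebesgue_integral lborel {(t, s). t \<ge> 0 \<and> s \<ge> 0 \<and> t + s \<le> 1}
            (\<lambda>(t :: real, s :: real).
               of_real t powr (b - 1) * of_real s powr (b' - 1) *
               (1 - u * of_real t) powr (- a) * (1 - v * of_real s) powr (- a') /
               of_real (1 - t - s) powr (1 - d))"
    unfolding set_lebesgue_integral_def lborel_prod
  proof (intro Bochner_Integration.integral_cong refl)
    fix p :: "real \<times> real"
    obtain t s where p: "p = (t, s)" by (metis surj_pair)
    \<comment> \<open>This includes \<open>r = 0\<close>, where both sides are zero.\<close>
    have "complex_of_real r powr (d - 1) = inverse (of_real r powr (1 - d))" for r
      using powr_minus[of "complex_of_real r" "1 - d"] by simp
    then show "f p = indicator {(t, s). t \<ge> 0 \<and> s \<ge> 0 \<and> t + s \<le> 1} p *\<^sub>R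
        (case p of (t, s) \<Rightarrow> of_real t powr (b - 1) * of_real s powr (b' - 1) *
               (1 - u * of_real t) powr (- a) * (1 - v * of_real s) powr (- a') /
               of_real (1 - t - s) powr (1 - d))"
      by (cases "t > 0 \<and> s > 0 \<and> t + s < 1")
        (auto simp: p f_def Appell_F3_kernel_def trunc_powr_def indicator_def divide_inverse
           not_less simp flip: of_real_diff)
  qed
  also have "Gamma (b + b' + d) / (Gamma b * Gamma b' * Gamma d) =
      k_Gamma k \<gamma> / (?k ^ 2 * k_Gamma k \<beta> * k_Gamma k \<beta>' * k_Gamma k (\<gamma> - \<beta> - \<beta>'))"
  proof -
    have "Re \<gamma> > 0" using re by simp
    then have "k_Gamma k \<gamma> = ?k powr (b + b' + d - 1) * Gamma (b + b' + d)"
      using k by (simp add: k_Gamma_conv_Gamma sum)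
    moreover have "?k powr (b + b' + d - 1) =
        ?k ^ 2 * ?k powr (b - 1) * ?k powr (b' - 1) * ?k powr (d - 1)"
      using k by (simp add: powr_diff powr_add power2_eq_square)
    ultimately show ?thesis
      using k re by (simp add: k_Gamma_conv_Gamma b_def b'_def d_def)
  qed
  finally show ?thesis
    unfolding a_def a'_def b_def b'_def d_def u_def v_def by simp
qed

theorem theorem8:
  fixes k :: real
    and x y \<alpha> \<alpha>' \<beta> \<beta>' \<gamma> \<gamma>' :: complex
  assumes "k > 0"
  shows
    "(Re \<gamma> > Re \<beta> \<and> Re \<beta> > 0 \<and> Re \<gamma>' > Re \<beta>' \<and> Re \<beta>' > 0 \<and> norm x + norm y < 1 / k \<longrightarrow>
        k_Appell_F2 k \<alpha> \<beta> \<beta>' \<gamma> \<gamma>' x y =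
          1 / (of_real k ^ 2 * k_Beta k \<beta> (\<gamma> - \<beta>) * k_Beta k \<beta>' (\<gamma>' - \<beta>')) *
          (LBINT s=0..1. (LBINT t=0..1.
             of_real t powr (\<beta> / of_real k - 1) * of_real s powr (\<beta>' / of_real k - 1) *
             of_real (1 - t) powr ((\<gamma> - \<beta>) / of_real k - 1) *
             of_real (1 - s) powr ((\<gamma>' - \<beta>') / of_real k - 1) /
             (1 - of_real k * x * of_real t - of_real k * y * of_real s) powr (\<alpha> / of_real k))))
     \<and>
     (Re \<beta> > 0 \<and> Re \<beta>' > 0 \<and> Re (\<gamma> - \<beta> - \<beta>') > 0 \<and> norm x < 1 / k \<and> norm y < 1 / k \<longrightarrow>
        k_Appell_F3 k \<alpha> \<alpha>' \<beta> \<beta>' \<gamma> x y =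
          k_Gamma k \<gamma> /
          (of_real k ^ 2 * k_Gamma k \<beta> * k_Gamma k \<beta>' * k_Gamma k (\<gamma> - \<beta> - \<beta>')) *
          set_lebesgue_integral lborel {(t, s). t \<ge> 0 \<and> s \<ge> 0 \<and> t + s \<le> 1}
            (\<lambda>(t :: real, s :: real).
               of_real t powr (\<beta> / of_real k - 1) * of_real s powr (\<beta>' / of_real k - 1) *
               (1 - of_real k * x * of_real t) powr (- \<alpha> / of_real k) *
               (1 - of_real k * y * of_real s) powr (- \<alpha>' / of_real k) /
               of_real (1 - t - s) powr (1 - (\<gamma> - \<beta> - \<beta>') / of_real k)))"
  using assms k_Appell_F2_eq k_Appell_F3_eq by blast

end
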